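(* (i) (necessity) If $x^*$ is a local minimum of $F$, then, with $\mathcal I^*=\mathcal I(x^* )$, $$d^T\nabla^2 f(x^* )d+\lambda\sum_{i\in\mathcal I^*}r''(|x_i^*|)d_i^2\ \ge\ 0\qquad\text{for all } d\in\mathcal M_{\mathcal I^*},$$ or, equivalently, $\lambda_{\min}(\nabla^2_{\mathcal I^*\mathcal I^*}F(x^* ))\ge 0$. (ii) (sufficiency) A stationary point $x^*$ of $F$ is a strict local minimum of $F$ if, with $\mathcal I^*=\mathcal I(x^* )$, $$d^T\nabla^2 f(x^* )d+\lambda\sum_{i\in\mathcal I^*}r''(|x_i^*|)d_i^2\ >\ 0\qquad\text{for all } d\in\mathcal M_{\mathcal I^*}\setminus\{0\},$$ or, equivalently, $\lambda_{\min}(\nabla^2_{\mathcal I^*\mathcal I^*}F(x^* ))>0$.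
   Context: Let $f:\mathbb R^n\to\mathbb R$ be twice continuously differentiable, $\lambda>0$, and $F(x)=f(x)+\lambda\sum_{i=1}^n r(|x_i|)$, where $r:[0,\infty)\to\mathbb R$ is continuous and concave with $r(0)=0$, is $C^2$ on $(0,\infty)$, satisfies $r'(t)\ge 0$ for all $t>0$, and $r'(0^+):=\lim_{t\to0^+}r'(t)\in(0,\infty]$ (the value $+\infty$ is allowed). For $x\in\mathbb R^n$: $\mathcal I(x)=\{i: x_i\ne0\}$, $\mathcal J(x)=\{i: x_i=0\}$. For $\mathcal I\subset\{1,\dots,n\}$: $\mathcal M_{\mathcal I}=\{u\in\mathbb R^n: u_j=0\ \forall j\notin\mathcal I\}$. A point $x^*$ is stationary for $F$ if $\nabla_i f(x^* )=-\lambda\,\mathrm{sign}(x_i^* )r'(|x_i^*|)$ for $i\in\mathcal I(x^* )$ and $\nabla_i f(x^* )\in(-\lambda r'(0^+),\lambda r'(0^+))$ for $i\in\mathcal J(x^* )$. $\nabla^2_{\mathcal I^*\mathcal I^*}F(x^* )$ is the Hessian of $F$ at $x^*$ with respect to the coordinates in $\mathcal I^*$ (where $F$ is $C^2$), i.e. $[\nabla^2 f(x^* )]_{\mathcal I^*\mathcal I^*}+\lambda\,\mathrm{diag}(r''(|x_i^*|))_{i\in\mathcal I^*}$; $\lambda_{\min}$ is the smallest eigenvalue. If $\mathcal I^*=\emptyset$ the conditions are regarded as vacuously satisfied. *)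

theory Defs
  imports "HOL-Analysis.Analysis"
begin

section \<open>Derivatives in coordinates\<close>

text \<open>Partial derivatives are derivatives along coordinate lines, so that they also make sense for
  functions which, like the objective below, are smooth only in some of the coordinates.\<close>

definition partial_derivative :: "'n::finite \<Rightarrow> (real ^ 'n \<Rightarrow> real) \<Rightarrow> real ^ 'n \<Rightarrow> real" where
  "partial_derivative i g x = deriv (\<lambda>t. g (x + t *\<^sub>R axis i 1)) 0"

definition gradient :: "(real ^ 'n::finite \<Rightarrow> real) \<Rightarrow> real ^ 'n \<Rightarrow> real ^ 'n" where
  "gradient g x = (\<chi> i. partial_derivative i g x)"

definition hessian :: "(real ^ 'n::finite \<Rightarrow> real) \<Rightarrow> real ^ 'n \<Rightarrow> real ^ 'n ^ 'n" where
  "hessian g x = (\<chi> i j. partial_derivative j (partial_derivative i g) x)"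

definition twice_continuously_differentiable :: "(real ^ 'n::finite \<Rightarrow> real) \<Rightarrow> bool" where
  "twice_continuously_differentiable f \<longleftrightarrow>
     (\<forall>x. f differentiable at x) \<and> (\<forall>x. gradient f differentiable at x) \<and>
     continuous_on UNIV (hessian f)"

definition C2_on_pos :: "(real \<Rightarrow> real) \<Rightarrow> bool" where
  "C2_on_pos r \<longleftrightarrow>
     (\<forall>t>0. r field_differentiable at t) \<and> (\<forall>t>0. deriv r field_differentiable at t) \<and>
     continuous_on {0<..} (deriv (deriv r))"

section \<open>Minimisers\<close>

definition local_minimum :: "('a::topological_space \<Rightarrow> real) \<Rightarrow> 'a \<Rightarrow> bool" where
  "local_minimum F x \<longleftrightarrow> (\<forall>\<^sub>F y in nhds x. F x \<le> F y)"

definition strict_local_minimum :: "('a::topological_space \<Rightarrow> real) \<Rightarrow> 'a \<Rightarrow> bool" where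
  "strict_local_minimum F x \<longleftrightarrow> (\<forall>\<^sub>F y in at x. F x < F y)"

section \<open>The penalised objective\<close>

text \<open>The penalty lives on \<open>[0,\<infinity>)\<close>; the values of \<open>r\<close> at negative reals are irrelevant.\<close>

definition objective ::
    "(real ^ 'n::finite \<Rightarrow> real) \<Rightarrow> real \<Rightarrow> (real \<Rightarrow> real) \<Rightarrow> real ^ 'n \<Rightarrow> real" where
  "objective f lam r x = f x + lam * (\<Sum>i\<in>UNIV. r \<bar>x $ i\<bar>)"

text \<open>The one-sided limit \<open>r'(0+)\<close>, which may be \<open>\<infinity>\<close>.\<close>

definition deriv_at_0_plus :: "(real \<Rightarrow> real) \<Rightarrow> ereal" where
  "deriv_at_0_plus r = Lim (at_right 0) (\<lambda>t. ereal (deriv r t))"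

definition admissible_penalty :: "(real \<Rightarrow> real) \<Rightarrow> bool" where
  "admissible_penalty r \<longleftrightarrow>
     continuous_on {0..} r \<and> concave_on {0..} r \<and> r 0 = 0 \<and> C2_on_pos r \<and>
     (\<forall>t>0. deriv r t \<ge> 0) \<and>
     ((\<lambda>t. ereal (deriv r t)) \<longlongrightarrow> deriv_at_0_plus r) (at_right 0) \<and> deriv_at_0_plus r > 0"

definition supp :: "real ^ 'n::finite \<Rightarrow> 'n set" where
  "supp x = {i. x $ i \<noteq> 0}"

definition coord_subspace :: "'n::finite set \<Rightarrow> (real ^ 'n) set" where
  "coord_subspace I = {u. \<forall>j. j \<notin> I \<longrightarrow> u $ j = 0}"

definition stationary ::
    "(real ^ 'n::finite \<Rightarrow> real) \<Rightarrow> real \<Rightarrow> (real \<Rightarrow> real) \<Rightarrow> real ^ 'n \<Rightarrow> bool" where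
  "stationary f lam r x \<longleftrightarrow>
     (\<forall>i \<in> supp x. gradient f x $ i = - lam * sgn (x $ i) * deriv r \<bar>x $ i\<bar>) \<and>
     (\<forall>i \<in> - supp x. ereal (gradient f x $ i) \<in>
        {- (ereal lam * deriv_at_0_plus r) <..< ereal lam * deriv_at_0_plus r})"

definition second_order_form ::
    "(real ^ 'n::finite \<Rightarrow> real) \<Rightarrow> real \<Rightarrow> (real \<Rightarrow> real) \<Rightarrow> real ^ 'n \<Rightarrow> real ^ 'n \<Rightarrow> real" where
  "second_order_form f lam r x d =
     d \<bullet> (hessian f x *v d) + lam * (\<Sum>i\<in>supp x. deriv (deriv r) \<bar>x $ i\<bar> * (d $ i)\<^sup>2)"

section \<open>Eigenvalues of a principal submatrix\<close>

text \<open>\<open>\<real>\<^sup>I\<close> is identified with the vectors supported in \<open>I\<close>. Only the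
  entries of \<open>A\<close> with both indices in \<open>I\<close> enter.\<close>

definition block_eigenvalue :: "real ^ 'n ^ 'n \<Rightarrow> 'n::finite set \<Rightarrow> real \<Rightarrow> bool" where
  "block_eigenvalue A I \<mu> \<longleftrightarrow>
     (\<exists>v \<in> coord_subspace I. v \<noteq> 0 \<and> (\<forall>i\<in>I. (\<Sum>j\<in>I. A $ i $ j * v $ j) = \<mu> * v $ i))"

text \<open>Meaningful for \<open>I \<noteq> {}\<close> and a symmetric block.\<close>

definition lambda_min :: "real ^ 'n ^ 'n \<Rightarrow> 'n::finite set \<Rightarrow> real" where
  "lambda_min A I = Min {\<mu>. block_eigenvalue A I \<mu>}"

section \<open>The Hessian of the objective in the nonzero coordinates\<close>

lemma partial_derivative_eqI:
  assumes "((\<lambda>t. g (x + t *\<^sub>R axis i 1)) has_real_derivative D) (at 0)"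
  shows "partial_derivative i g x = D"
  using assms unfolding partial_derivative_def by (rule DERIV_imp_deriv)

lemma has_partial_derivative:
  fixes g :: "real ^ 'n::finite \<Rightarrow> real"
  assumes "g differentiable at x"
  shows "((\<lambda>t. g (x + t *\<^sub>R axis i 1)) has_real_derivative partial_derivative i g x) (at 0)"
proof -
  have "((\<lambda>t::real. x + t *\<^sub>R axis i 1) has_derivative (\<lambda>t. t *\<^sub>R axis i 1)) (at 0)"
    by (auto intro!: derivative_eq_intros)
  then have "(\<lambda>t::real. x + t *\<^sub>R axis i 1) differentiable at 0"
    by (auto simp: differentiable_def)
  moreover have "g differentiable at (x + 0 *\<^sub>R axis i 1)"
    using assms by simp
  ultimately have "(g \<circ> (\<lambda>t::real. x + t *\<^sub>R axis i 1)) differentiable at 0"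
    by (rule differentiable_chain_at)
  then have "(\<lambda>t::real. g (x + t *\<^sub>R axis i 1)) differentiable at 0"
    by (simp add: o_def)
  then have "(\<lambda>t::real. g (x + t *\<^sub>R axis i 1)) field_differentiable at 0"
    by (metis real_differentiable_def field_differentiable_def)
  then show ?thesis
    unfolding partial_derivative_def by (simp add: DERIV_deriv_iff_field_differentiable)
qed

lemma has_derivative_abs_line:
  assumes "C2_on_pos r" "y \<noteq> (0::real)"
  shows "((\<lambda>t. r \<bar>y + t\<bar>) has_real_derivative sgn y * deriv r \<bar>y\<bar>) (at 0)"
    and "((\<lambda>t. sgn (y + t) * deriv r \<bar>y + t\<bar>) has_real_derivative deriv (deriv r) \<bar>y\<bar>) (at 0)"
proof -
  have r1: "(r has_real_derivative deriv r \<bar>y\<bar>) (at \<bar>y\<bar>)"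
    and r2: "(deriv r has_real_derivative deriv (deriv r) \<bar>y\<bar>) (at \<bar>y\<bar>)"
    using assms by (auto simp: C2_on_pos_def DERIV_deriv_iff_field_differentiable)
  define s where "s = sgn y"
  have s: "s * y = \<bar>y\<bar>" "s * s = 1"
    using assms(2) by (auto simp: s_def sgn_if)
  have lin: "((\<lambda>t. s * (y + t)) has_real_derivative s) (at 0)"
    by (auto intro!: derivative_eq_intros)
  have "\<forall>\<^sub>F t in nhds 0. \<bar>t\<bar> < \<bar>y\<bar>"
    using assms(2) by (intro eventually_nhds_metric[THEN iffD2] exI[of _ "\<bar>y\<bar>"]) (auto simp: dist_norm)
  then have ev: "\<forall>\<^sub>F t in nhds 0. s * (y + t) = \<bar>y + t\<bar> \<and> sgn (y + t) = s"
    by eventually_elim (auto simp: s_def sgn_if abs_if split: if_splits)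
  have "((\<lambda>t. r (s * (y + t))) has_real_derivative deriv r \<bar>y\<bar> * s) (at 0)"
    by (rule DERIV_chain'[OF lin]) (use r1 s in simp)
  moreover have "\<forall>\<^sub>F t in nhds 0. r (s * (y + t)) = r \<bar>y + t\<bar>"
    using ev by eventually_elim simp
  ultimately show "((\<lambda>t. r \<bar>y + t\<bar>) has_real_derivative sgn y * deriv r \<bar>y\<bar>) (at 0)"
    by (subst (asm) DERIV_cong_ev[OF refl _ refl]) (auto simp: s_def mult.commute)
  have "((\<lambda>t. s * deriv r (s * (y + t))) has_real_derivative
          s * (deriv (deriv r) \<bar>y\<bar> * s)) (at 0)"
    by (intro DERIV_cmult DERIV_chain'[OF lin]) (use r2 s in simp)
  moreover have "s * (deriv (deriv r) \<bar>y\<bar> * s) = deriv (deriv r) \<bar>y\<bar>"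
    using s(2) by (metis mult.assoc mult.commute mult_1)
  moreover have "\<forall>\<^sub>F t in nhds 0. s * deriv r (s * (y + t)) = sgn (y + t) * deriv r \<bar>y + t\<bar>"
    using ev by eventually_elim simp
  ultimately show "((\<lambda>t. sgn (y + t) * deriv r \<bar>y + t\<bar>) has_real_derivative
      deriv (deriv r) \<bar>y\<bar>) (at 0)"
    by (subst (asm) DERIV_cong_ev[OF refl _ refl]) auto
qed

lemma partial_derivative_objective:
  fixes f :: "real ^ 'n::finite \<Rightarrow> real"
  assumes "f differentiable at x" "C2_on_pos r" "x $ i \<noteq> 0"
  shows "partial_derivative i (objective f lam r) x =
    partial_derivative i f x + lam * (sgn (x $ i) * deriv r \<bar>x $ i\<bar>)"
proof (rule partial_derivative_eqI)
  have eq: "objective f lam r (x + t *\<^sub>R axis i 1) =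
      f (x + t *\<^sub>R axis i 1) + lam * (r \<bar>x $ i + t\<bar> + (\<Sum>k\<in>UNIV - {i}. r \<bar>x $ k\<bar>))" for t
  proof -
    have "(\<Sum>k\<in>UNIV. r \<bar>(x + t *\<^sub>R axis i 1) $ k\<bar>) = r \<bar>(x + t *\<^sub>R axis i 1) $ i\<bar>
        + (\<Sum>k\<in>UNIV - {i}. r \<bar>(x + t *\<^sub>R axis i 1) $ k\<bar>)"
      by (rule sum.remove) auto
    also have "\<dots> = r \<bar>x $ i + t\<bar> + (\<Sum>k\<in>UNIV - {i}. r \<bar>x $ k\<bar>)"
      by (intro arg_cong2[where f = "(+)"] sum.cong) (auto simp: axis_def)
    finally show ?thesis by (simp add: objective_def)
  qed
  show "((\<lambda>t. objective f lam r (x + t *\<^sub>R axis i 1)) has_real_derivative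
      partial_derivative i f x + lam * (sgn (x $ i) * deriv r \<bar>x $ i\<bar>)) (at 0)"
    unfolding eq
    by (rule derivative_eq_intros has_partial_derivative[OF assms(1)]
        has_derivative_abs_line(1)[OF assms(2,3)] refl | simp)+
qed

text \<open>On the block of nonzero coordinates the Hessian of the objective has the expected form.\<close>

lemma hessian_objective:
  fixes f :: "real ^ 'n::finite \<Rightarrow> real"
  assumes "twice_continuously_differentiable f" "C2_on_pos r" "i \<in> supp x" "j \<in> supp x"
  shows "hessian (objective f lam r) x $ i $ j =
    hessian f x $ i $ j + (if i = j then lam * deriv (deriv r) \<bar>x $ i\<bar> else 0)"
proof -
  have df: "f differentiable at y" for y
    using assms(1) by (simp add: twice_continuously_differentiable_def)
  obtain G where "(gradient f has_derivative G) (at x)"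
    using assms(1) by (auto simp: twice_continuously_differentiable_def differentiable_def)
  then have "((\<lambda>y. gradient f y $ i) has_derivative (\<lambda>h. G h $ i)) (at x)"
    by (rule bounded_linear.has_derivative[OF bounded_linear_vec_nth])
  then have "(\<lambda>y. gradient f y $ i) differentiable at x"
    by (auto simp: differentiable_def)
  then have d2: "partial_derivative i f differentiable at x"
    by (simp add: gradient_def)
  have xi: "x $ i \<noteq> 0" using assms(3) by (simp add: supp_def)
  let ?p = "\<lambda>t. x $ i + (if i = j then t else 0)"
  have pi: "(x + t *\<^sub>R axis j 1) $ i = ?p t" for t by (simp add: axis_def)
  have "\<forall>\<^sub>F t in nhds 0. \<bar>t\<bar> < \<bar>x $ i\<bar>"
    using xi by (intro eventually_nhds_metric[THEN iffD2] exI[of _ "\<bar>x $ i\<bar>"]) (auto simp: dist_norm)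
  then have ev: "\<forall>\<^sub>F t in nhds 0. partial_derivative i f (x + t *\<^sub>R axis j 1) +
      lam * (sgn (?p t) * deriv r \<bar>?p t\<bar>) =
      partial_derivative i (objective f lam r) (x + t *\<^sub>R axis j 1)"
  proof eventually_elim
    case (elim t)
    then have "?p t \<noteq> 0" by auto
    then show ?case
      using partial_derivative_objective[OF df assms(2), of "x + t *\<^sub>R axis j 1" i lam]
      unfolding pi by simp
  qed
  have "((\<lambda>t. sgn (?p t) * deriv r \<bar>?p t\<bar>) has_real_derivative
      (if i = j then deriv (deriv r) \<bar>x $ i\<bar> else 0)) (at 0)"
    using has_derivative_abs_line(2)[OF assms(2) xi] by (cases "i = j") simp_all
  then have "((\<lambda>t. partial_derivative i f (x + t *\<^sub>R axis j 1) +
      lam * (sgn (?p t) * deriv r \<bar>?p t\<bar>)) has_real_derivative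
      partial_derivative j (partial_derivative i f) x +
      lam * (if i = j then deriv (deriv r) \<bar>x $ i\<bar> else 0)) (at 0)"
    by (intro DERIV_add has_partial_derivative[OF d2] DERIV_cmult)
  then have "((\<lambda>t. partial_derivative i (objective f lam r) (x + t *\<^sub>R axis j 1))
      has_real_derivative partial_derivative j (partial_derivative i f) x +
      lam * (if i = j then deriv (deriv r) \<bar>x $ i\<bar> else 0)) (at 0)"
    by (subst (asm) DERIV_cong_ev[OF refl ev refl])
  then have "partial_derivative j (partial_derivative i (objective f lam r)) x =
      partial_derivative j (partial_derivative i f) x +
      lam * (if i = j then deriv (deriv r) \<bar>x $ i\<bar> else 0)"
    by (rule partial_derivative_eqI)
  then show ?thesis by (simp add: hessian_def)
qed

end

theory Submission
  imports Defs
begin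

text \<open>Near \<open>x\<close>, the objective is the sum of a \<open>C\<^sup>2\<close> function, made of \<open>f\<close> and the penalties of the
  nonzero coordinates, and of the penalties of the zero coordinates. Second-order Taylor expansion
  of the first part gives the necessary condition along the subspace of the nonzero coordinates,
  where the second part vanishes. For sufficiency, the bound on the gradient in the zero coordinates
  makes the second part dominate the linear term, with linear growth to spare. The eigenvalue
  reformulations are the Rayleigh principle for the block of the Hessian, which is symmetric because
  the gradient is differentiable.\<close>

section \<open>Second derivatives of functions with a differentiable gradient\<close>

lemma has_derivative_along_segment:
  fixes f :: "'a::real_inner \<Rightarrow> real"
  assumes "(f has_derivative (\<lambda>h. c \<bullet> h)) (at (a + t *\<^sub>R v))"
  shows "((\<lambda>s. f (a + s *\<^sub>R v)) has_real_derivative c \<bullet> v) (at t)"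
proof -
  have "((\<lambda>s. a + s *\<^sub>R v) has_derivative (\<lambda>h. h *\<^sub>R v)) (at t)"
    by (auto intro!: derivative_eq_intros)
  from has_derivative_compose[OF this assms]
  show ?thesis by (simp add: has_field_derivative_def mult_commute_abs)
qed

text \<open>Along the segment the remainder has as derivative the first-order error of
  \<open>g\<close> at \<open>x\<close>, paired with \<open>h\<close>. One mean value step therefore
  turns differentiability of \<open>g\<close> at \<open>x\<close> into the quadratic bound.\<close>

lemma second_order_Taylor_Peano:
  fixes f :: "'a::real_inner \<Rightarrow> real"
  assumes f: "\<forall>\<^sub>F y in nhds x. (f has_derivative (\<lambda>h. g y \<bullet> h)) (at y)"
    and g: "(g has_derivative G) (at x)" and e: "e > 0"
  shows "\<forall>\<^sub>F h in nhds 0. \<bar>f (x + h) - f x - g x \<bullet> h - (h \<bullet> G h) / 2\<bar> \<le> e * (norm h)\<^sup>2"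
proof -
  obtain d1 where d1: "d1 > 0" "\<And>y. dist y x < d1 \<Longrightarrow> (f has_derivative (\<lambda>h. g y \<bullet> h)) (at y)"
    using f by (auto simp: eventually_nhds_metric)
  obtain d2 where d2: "d2 > 0"
    "\<And>y. norm (y - x) < d2 \<Longrightarrow> norm (g y - g x - G (y - x)) \<le> e * norm (y - x)"
    using g e unfolding has_derivative_at_alt by blast
  interpret G: bounded_linear G using g by (rule has_derivative_bounded_linear)
  have "\<bar>f (x + h) - f x - g x \<bullet> h - (h \<bullet> G h) / 2\<bar> \<le> e * (norm h)\<^sup>2"
    if h: "norm h < min d1 d2" for h
  proof -
    \<comment> \<open>Chosen so that \<open>?\<phi> 1 - ?\<phi> 0\<close> is exactly the Taylor
      remainder.\<close>
    let ?\<phi> = "\<lambda>t. f (x + t *\<^sub>R h) - t * (g x \<bullet> h) - t\<^sup>2 / 2 * (h \<bullet> G h)"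
    let ?\<phi>' = "\<lambda>t. g (x + t *\<^sub>R h) \<bullet> h - g x \<bullet> h - t * (h \<bullet> G h)"
    have sm: "norm (t *\<^sub>R h) < min d1 d2" if "0 \<le> t" "t \<le> 1" for t
      using h mult_left_le_one_le[of "norm h" t] that by simp
    have "(?\<phi> has_real_derivative ?\<phi>' t) (at t)" if "0 \<le> t" "t \<le> 1" for t
    proof -
      have "(f has_derivative (\<lambda>v. g (x + t *\<^sub>R h) \<bullet> v)) (at (x + t *\<^sub>R h))"
        using sm[OF that] by (intro d1) (simp add: dist_norm)
      from has_derivative_along_segment[OF this]
      show ?thesis by (auto intro!: derivative_eq_intros)
    qed
    with MVT2[of 0 1 ?\<phi> ?\<phi>'] obtain t where t: "0 < t" "t < 1" "?\<phi> 1 - ?\<phi> 0 = ?\<phi>' t" by auto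
    have "\<bar>?\<phi>' t\<bar> = \<bar>(g (x + t *\<^sub>R h) - g x - G (t *\<^sub>R h)) \<bullet> h\<bar>"
      by (simp add: G.scaleR inner_diff_left inner_diff_right inner_commute)
    also have "\<dots> \<le> norm (g (x + t *\<^sub>R h) - g x - G (t *\<^sub>R h)) * norm h"
      by (rule Cauchy_Schwarz_ineq2)
    also have "\<dots> \<le> e * norm (t *\<^sub>R h) * norm h"
      using d2(2)[of "x + t *\<^sub>R h"] sm[of t] t by (intro mult_right_mono) auto
    also have "\<dots> \<le> e * (norm h)\<^sup>2"
      using t e mult_left_le_one_le[of "(norm h)\<^sup>2" t] by (simp add: power2_eq_square mult.assoc)
    finally show ?thesis using t(3) by simp
  qed
  then show ?thesis
    using d1(1) d2(1) by (intro eventually_nhds_metric[THEN iffD2] exI[of _ "min d1 d2"]) auto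
qed

text \<open>The second difference over the parallelogram spanned by \<open>t u\<close> and \<open>t v\<close> is
  \<open>t\<^sup>2 (u \<bullet> G v) + o(t\<^sup>2)\<close>, but it is symmetric in \<open>u\<close> and \<open>v\<close>.\<close>

lemma second_difference_bound:
  fixes f :: "'a::real_inner \<Rightarrow> real"
  assumes f: "\<And>y. norm (y - x) < d \<Longrightarrow> (f has_derivative (\<lambda>h. g y \<bullet> h)) (at y)"
    and G: "bounded_linear G"
    and g: "\<And>y. norm (y - x) < d \<Longrightarrow> norm (g y - g x - G (y - x)) \<le> e * norm (y - x)"
    and t: "0 < t" "t * (norm u + norm v) < d" and e: "e > 0"
  shows "\<bar>f (x + t *\<^sub>R u + t *\<^sub>R v) - f (x + t *\<^sub>R u) - f (x + t *\<^sub>R v) + f x - t\<^sup>2 * (u \<bullet> G v)\<bar>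
    \<le> 2 * e * t\<^sup>2 * (norm u + norm v)\<^sup>2"
proof -
  interpret G: bounded_linear G by (rule G)
  let ?N = "norm u + norm v"
  \<comment> \<open>The increment along \<open>t *\<^sub>R v\<close> as a function of the position
    along \<open>u\<close>: the second difference is \<open>?\<phi> t - ?\<phi> 0\<close>, so a
    single mean value step handles it.\<close>
  let ?\<phi> = "\<lambda>s. f ((x + t *\<^sub>R v) + s *\<^sub>R u) - f (x + s *\<^sub>R u)"
  let ?\<phi>' = "\<lambda>s. g ((x + t *\<^sub>R v) + s *\<^sub>R u) \<bullet> u - g (x + s *\<^sub>R u) \<bullet> u"
  have n1: "norm (t *\<^sub>R v + s *\<^sub>R u) \<le> t * ?N" if "0 \<le> s" "s \<le> t" for s
  proof -
    have "norm (t *\<^sub>R v + s *\<^sub>R u) \<le> t * norm v + s * norm u"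
      using norm_triangle_ineq[of "t *\<^sub>R v" "s *\<^sub>R u"] that t by simp
    also have "\<dots> \<le> t * norm v + t * norm u" using that by (simp add: mult_right_mono)
    finally show ?thesis by (simp add: algebra_simps)
  qed
  have n2: "norm (s *\<^sub>R u) \<le> t * ?N" if "0 \<le> s" "s \<le> t" for s
    using that t by (simp add: mult_mono)
  have eqs: "x + t *\<^sub>R v + s *\<^sub>R u - x = t *\<^sub>R v + s *\<^sub>R u" for s by simp
  have "(?\<phi> has_real_derivative ?\<phi>' s) (at s)" if s: "0 \<le> s" "s \<le> t" for s
  proof (rule DERIV_diff; rule has_derivative_along_segment; rule f)
    show "norm (x + t *\<^sub>R v + s *\<^sub>R u - x) < d"
      unfolding eqs using n1[OF s] t(2) by linarith
    show "norm (x + s *\<^sub>R u - x) < d" using n2[OF s] t(2) by simp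
  qed
  with MVT2[of 0 t ?\<phi> ?\<phi>'] t obtain s where s: "0 < s" "s < t" "?\<phi> t - ?\<phi> 0 = t * ?\<phi>' s" by auto
  let ?E1 = "g (x + t *\<^sub>R v + s *\<^sub>R u) - g x - G (t *\<^sub>R v + s *\<^sub>R u)"
  let ?E2 = "g (x + s *\<^sub>R u) - g x - G (s *\<^sub>R u)"
  have E1: "norm ?E1 \<le> e * (t * ?N)"
  proof -
    have "norm (x + t *\<^sub>R v + s *\<^sub>R u - x) < d" unfolding eqs using n1[of s] s t(2) by simp
    from g[OF this] have "norm ?E1 \<le> e * norm (t *\<^sub>R v + s *\<^sub>R u)" unfolding eqs .
    also have "\<dots> \<le> e * (t * ?N)" using n1[of s] s e by simp
    finally show ?thesis .
  qed
  have E2: "norm ?E2 \<le> e * (t * ?N)"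
  proof -
    have "norm (x + s *\<^sub>R u - x) < d" using n2[of s] s t(2) by simp
    from g[OF this] have "norm ?E2 \<le> e * norm (s *\<^sub>R u)" by simp
    also have "\<dots> \<le> e * (t * ?N)" using n2[of s] s e by (intro mult_left_mono) auto
    finally show ?thesis .
  qed
  \<comment> \<open>By linearity \<open>G (t *\<^sub>R v + s *\<^sub>R u) - G (s *\<^sub>R u) = t
    *\<^sub>R G v\<close>, so the unknown intermediate point \<open>s\<close> drops out of the main
    term.\<close>
  have "t * ?\<phi>' s - t\<^sup>2 * (u \<bullet> G v) = t * ((?E1 - ?E2) \<bullet> u)"
    by (simp add: G.scaleR G.add inner_diff_left inner_add_left inner_commute[of u] power2_eq_square
        algebra_simps)
  then have "\<bar>t * ?\<phi>' s - t\<^sup>2 * (u \<bullet> G v)\<bar> = t * \<bar>(?E1 - ?E2) \<bullet> u\<bar>"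
    using t by (simp add: abs_mult)
  also have "\<dots> \<le> t * (norm (?E1 - ?E2) * norm u)"
    using t Cauchy_Schwarz_ineq2 by (intro mult_left_mono) auto
  also have "\<dots> \<le> t * ((2 * e * (t * ?N)) * ?N)"
    using t E1 E2 norm_triangle_ineq4[of ?E1 ?E2] e by (intro mult_left_mono mult_mono) auto
  also have "\<dots> = 2 * e * t\<^sup>2 * ?N\<^sup>2" by (simp add: power2_eq_square)
  finally show ?thesis using s(3) by (simp add: algebra_simps)
qed

text \<open>Both bilinear values approximate the same second difference divided by
  \<open>t\<^sup>2\<close>, with an error proportional to \<open>e\<close>, and \<open>e\<close> is
  arbitrary.\<close>

lemma second_derivative_symmetric:
  fixes f :: "'a::real_inner \<Rightarrow> real"
  assumes f: "\<forall>\<^sub>F y in nhds x. (f has_derivative (\<lambda>h. g y \<bullet> h)) (at y)"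
    and g: "(g has_derivative G) (at x)"
  shows "u \<bullet> G v = v \<bullet> G u"
proof -
  let ?N = "norm u + norm v"
  have G: "bounded_linear G" using g by (rule has_derivative_bounded_linear)
  have "\<bar>u \<bullet> G v - v \<bullet> G u\<bar> \<le> e * (4 * ?N\<^sup>2)" if e: "e > 0" for e
  proof -
    obtain d1 where d1: "d1 > 0" "\<And>y. dist y x < d1 \<Longrightarrow> (f has_derivative (\<lambda>h. g y \<bullet> h)) (at y)"
      using f by (auto simp: eventually_nhds_metric)
    obtain d2 where d2: "d2 > 0"
      "\<And>y. norm (y - x) < d2 \<Longrightarrow> norm (g y - g x - G (y - x)) \<le> e * norm (y - x)"
      using g e unfolding has_derivative_at_alt by blast
    define d where "d = min d1 d2"
    \<comment> \<open>Gives \<open>t * ?N \<le> d / 2 < d\<close>; the \<open>+ 1\<close> keeps the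
      denominator positive when both vectors vanish.\<close>
    define t where "t = d / (2 * (?N + 1))"
    have d: "d > 0" using d1 d2 by (simp add: d_def)
    have N: "?N \<ge> 0" by simp
    have t: "0 < t" unfolding t_def using d add_nonneg_pos[OF N zero_less_one] by (intro divide_pos_pos mult_pos_pos) auto
    have "t * ?N \<le> t * (?N + 1)" using t by (intro mult_left_mono) auto
    also have "\<dots> = d / 2" using N unfolding t_def by (simp add: field_simps add_nonneg_eq_0_iff)
    finally have tN: "t * ?N < d" "t * (norm v + norm u) < d" using d by (auto simp: add.commute)
    note B = second_difference_bound[of x d f g G e t, OF _ G _ t _ e]
    let ?S = "f (x + t *\<^sub>R u + t *\<^sub>R v) - f (x + t *\<^sub>R u) - f (x + t *\<^sub>R v) + f x"
    have "\<bar>?S - t\<^sup>2 * (u \<bullet> G v)\<bar> \<le> 2 * e * t\<^sup>2 * ?N\<^sup>2"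
      by (rule B) (use d1 d2 tN in \<open>auto simp: d_def dist_norm\<close>)
    \<comment> \<open>The same bound with \<open>u\<close> and \<open>v\<close> exchanged; by
      commutativity its second difference is again \<open>?S\<close>.\<close>
    moreover have "\<bar>f (x + t *\<^sub>R v + t *\<^sub>R u) - f (x + t *\<^sub>R v) - f (x + t *\<^sub>R u) + f x - t\<^sup>2 * (v \<bullet> G u)\<bar>
        \<le> 2 * e * t\<^sup>2 * (norm v + norm u)\<^sup>2"
      by (rule B) (use d1 d2 tN in \<open>auto simp: d_def dist_norm\<close>)
    then have "\<bar>?S - t\<^sup>2 * (v \<bullet> G u)\<bar> \<le> 2 * e * t\<^sup>2 * ?N\<^sup>2"
      by (simp add: add_ac)
    ultimately have "\<bar>t\<^sup>2 * (u \<bullet> G v) - t\<^sup>2 * (v \<bullet> G u)\<bar> \<le> 4 * e * t\<^sup>2 * ?N\<^sup>2" by linarith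
    also have "\<bar>t\<^sup>2 * (u \<bullet> G v) - t\<^sup>2 * (v \<bullet> G u)\<bar> = t\<^sup>2 * \<bar>u \<bullet> G v - v \<bullet> G u\<bar>"
      by (simp add: abs_mult flip: right_diff_distrib)
    also have "4 * e * t\<^sup>2 * ?N\<^sup>2 = t\<^sup>2 * (e * (4 * ?N\<^sup>2))" by simp
    finally have "t\<^sup>2 * \<bar>u \<bullet> G v - v \<bullet> G u\<bar> \<le> t\<^sup>2 * (e * (4 * ?N\<^sup>2))" .
    then show ?thesis using t by simp
  qed
  note bound = this
  have "\<bar>u \<bullet> G v - v \<bullet> G u\<bar> \<le> 0"
  proof (rule field_le_epsilon)
    fix e :: real assume e: "e > 0"
    \<comment> \<open>The bound is applied with \<open>e\<close> divided by this number, which is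
      positive even for \<open>?N = 0\<close>.\<close>
    have n: "4 * ?N\<^sup>2 + 1 > 0" by (intro add_nonneg_pos) auto
    have "\<bar>u \<bullet> G v - v \<bullet> G u\<bar> \<le> e / (4 * ?N\<^sup>2 + 1) * (4 * ?N\<^sup>2)"
      by (rule bound) (use e n in simp)
    also have "\<dots> \<le> e / (4 * ?N\<^sup>2 + 1) * (4 * ?N\<^sup>2 + 1)"
      using e n by (intro mult_left_mono divide_nonneg_pos) auto
    also have "\<dots> = 0 + e" using n by simp
    finally show "\<bar>u \<bullet> G v - v \<bullet> G u\<bar> \<le> 0 + e" .
  qed
  then show ?thesis by simp
qed

section \<open>Gradient and Hessian as total derivatives\<close>

text \<open>A total derivative is determined by its values on the axis vectors, and these are the
  partial derivatives.\<close>

lemma has_derivative_gradient: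
  fixes f :: "real ^ 'n::finite \<Rightarrow> real"
  assumes "f differentiable at x"
  shows "(f has_derivative (\<lambda>h. gradient f x \<bullet> h)) (at x)"
proof -
  obtain D where D: "(f has_derivative D) (at x)"
    using assms by (auto simp: differentiable_def)
  interpret D: bounded_linear D using D by (rule has_derivative_bounded_linear)
  have "D h = gradient f x \<bullet> h" for h
  proof -
    have "partial_derivative i f x = D (axis i 1)" for i
    proof (rule partial_derivative_eqI)
      have "((\<lambda>t::real. x + t *\<^sub>R axis i 1) has_derivative (\<lambda>t. t *\<^sub>R axis i 1)) (at 0)"
        by (auto intro!: derivative_eq_intros)
      from has_derivative_compose[OF this, of f D] D
      show "((\<lambda>t. f (x + t *\<^sub>R axis i 1)) has_real_derivative D (axis i 1)) (at 0)"
        by (simp add: has_field_derivative_def D.scaleR mult_commute_abs)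
    qed
    then have "gradient f x \<bullet> h = (\<Sum>i\<in>UNIV. h $ i * D (axis i 1))"
      by (simp add: gradient_def inner_vec_def mult.commute)
    also have "\<dots> = D (\<Sum>i\<in>UNIV. h $ i *\<^sub>R axis i 1)"
      by (simp add: D.sum D.scaleR)
    also have "(\<Sum>i\<in>UNIV. h $ i *\<^sub>R axis i 1) = h"
      using basis_expansion[of h] by (simp add: scalar_mult_eq_scaleR)
    finally show ?thesis by simp
  qed
  then have "D = (\<lambda>h. gradient f x \<bullet> h)" by blast
  with D show ?thesis by simp
qed

text \<open>Component \<open>i\<close> of the gradient is \<open>partial_derivative i f\<close>, and
  its own gradient is row \<open>i\<close> of the Hessian; the components are then
  reassembled.\<close>

lemma has_derivative_hessian:
  fixes f :: "real ^ 'n::finite \<Rightarrow> real"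
  assumes "gradient f differentiable at x"
  shows "(gradient f has_derivative (\<lambda>h. hessian f x *v h)) (at x)"
proof -
  have comp: "((\<lambda>y. gradient f y $ i) has_derivative (\<lambda>h. (hessian f x *v h) $ i)) (at x)" for i
  proof -
    obtain G where "(gradient f has_derivative G) (at x)"
      using assms by (auto simp: differentiable_def)
    then have "((\<lambda>y. gradient f y $ i) has_derivative (\<lambda>h. G h $ i)) (at x)"
      by (rule bounded_linear.has_derivative[OF bounded_linear_vec_nth])
    then have "partial_derivative i f differentiable at x"
      by (auto simp: differentiable_def gradient_def)
    from has_derivative_gradient[OF this] show ?thesis
      by (simp add: gradient_def hessian_def matrix_vector_mult_def inner_vec_def)
  qed
  show ?thesis
    by (subst has_derivative_componentwise_within)
      (use comp in \<open>auto simp: Basis_vec_def inner_axis\<close>)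
qed

lemma hessian_symmetric:
  fixes f :: "real ^ 'n::finite \<Rightarrow> real"
  assumes "twice_continuously_differentiable f"
  shows "u \<bullet> (hessian f x *v v) = v \<bullet> (hessian f x *v u)"
proof (rule second_derivative_symmetric)
  show "\<forall>\<^sub>F y in nhds x. (f has_derivative (\<lambda>h. gradient f y \<bullet> h)) (at y)"
    using assms unfolding twice_continuously_differentiable_def
    by (blast intro: has_derivative_gradient always_eventually)
  show "(gradient f has_derivative (*v) (hessian f x)) (at x)"
    using assms by (auto simp: twice_continuously_differentiable_def intro: has_derivative_hessian)
qed

section \<open>The smallest eigenvalue of a principal block\<close>

lemma coord_subspace_axis: "i \<in> I \<Longrightarrow> axis i 1 \<in> coord_subspace I"
  by (auto simp: coord_subspace_def axis_def)

lemma coord_subspace_linear: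
  "u \<in> coord_subspace I \<Longrightarrow> v \<in> coord_subspace I \<Longrightarrow> u + c *\<^sub>R v \<in> coord_subspace I"
  by (auto simp: coord_subspace_def)

lemma closed_coord_subspace: "closed (coord_subspace I)"
proof -
  have "coord_subspace I = (\<Inter>j\<in>-I. {u. u $ j = 0})" by (auto simp: coord_subspace_def)
  then show ?thesis
    by (auto intro!: closed_INT closed_Collect_eq continuous_intros)
qed

lemma matrix_vector_mult_nth_coord_subspace:
  fixes A :: "real ^ 'n::finite ^ 'm"
  assumes "v \<in> coord_subspace I"
  shows "(A *v v) $ i = (\<Sum>j\<in>I. A $ i $ j * v $ j)"
  unfolding matrix_vector_mult_def vec_lambda_beta
  by (rule sum.mono_neutral_right) (use assms in \<open>auto simp: coord_subspace_def\<close>)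

lemma inner_coord_subspace:
  fixes v w :: "real ^ 'n::finite"
  assumes "v \<in> coord_subspace I"
  shows "v \<bullet> w = (\<Sum>i\<in>I. v $ i * w $ i)"
  unfolding inner_vec_def inner_real_def
  by (rule sum.mono_neutral_right) (use assms in \<open>auto simp: coord_subspace_def\<close>)

text \<open>The weak form of the eigenvalue equation: the sums over the block become inner products
  on the subspace, and testing with axis vectors recovers the coordinates.\<close>

lemma block_eigenvalue_iff:
  "block_eigenvalue A I \<mu> \<longleftrightarrow>
    (\<exists>v \<in> coord_subspace I. v \<noteq> 0 \<and> (\<forall>w \<in> coord_subspace I. w \<bullet> (A *v v) = \<mu> * (w \<bullet> v)))"
proof -
  have "(\<forall>i\<in>I. (\<Sum>j\<in>I. A $ i $ j * v $ j) = \<mu> * v $ i) \<longleftrightarrow>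
      (\<forall>w \<in> coord_subspace I. w \<bullet> (A *v v) = \<mu> * (w \<bullet> v))" (is "?L \<longleftrightarrow> ?R")
    if v: "v \<in> coord_subspace I" for v :: "real ^ 'a"
  proof
    assume ?L
    then show ?R
      by (auto simp: inner_coord_subspace matrix_vector_mult_nth_coord_subspace[OF v]
          sum_distrib_left mult_ac intro!: sum.cong)
  next
    assume R: ?R
    show ?L
    proof
      fix i assume "i \<in> I"
      from R[rule_format, OF coord_subspace_axis[OF this]]
      show "(\<Sum>j\<in>I. A $ i $ j * v $ j) = \<mu> * v $ i"
        by (simp add: inner_axis' matrix_vector_mult_nth_coord_subspace[OF v])
    qed
  qed
  then show ?thesis unfolding block_eigenvalue_def by blast
qed

text \<open>Used to exchange the Hessian of the objective, whose formula is available only on the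
  block, for a matrix known everywhere.\<close>

lemma lambda_min_cong:
  assumes "\<And>i j. i \<in> I \<Longrightarrow> j \<in> I \<Longrightarrow> A $ i $ j = B $ i $ j"
  shows "lambda_min A I = lambda_min B I"
  using assms by (simp add: lambda_min_def block_eigenvalue_def)

text \<open>Eigenvectors for distinct eigenvalues are orthogonal, hence independent, so the
  dimension bounds their number. Finiteness gives the \<open>Min\<close> in
  \<open>lambda_min\<close> its meaning.\<close>

lemma finite_block_eigenvalues:
  fixes A :: "real ^ 'n::finite ^ 'n"
  assumes sym: "\<And>u v. u \<bullet> (A *v v) = v \<bullet> (A *v u)"
  shows "finite {\<mu>. block_eigenvalue A I \<mu>}"
proof -
  let ?E = "{\<mu>. block_eigenvalue A I \<mu>}"
  obtain v where v: "\<And>\<mu>. \<mu> \<in> ?E \<Longrightarrow> v \<mu> \<in> coord_subspace I" "\<And>\<mu>. \<mu> \<in> ?E \<Longrightarrow> v \<mu> \<noteq> 0"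
    "\<And>\<mu> w. \<mu> \<in> ?E \<Longrightarrow> w \<in> coord_subspace I \<Longrightarrow> w \<bullet> (A *v v \<mu>) = \<mu> * (w \<bullet> v \<mu>)"
  proof -
    have "\<forall>\<mu>\<in>?E. \<exists>v. v \<in> coord_subspace I \<and> v \<noteq> 0 \<and>
        (\<forall>w \<in> coord_subspace I. w \<bullet> (A *v v) = \<mu> * (w \<bullet> v))"
      unfolding block_eigenvalue_iff by blast
    from bchoice[OF this] show ?thesis using that by blast
  qed
  \<comment> \<open>Test each eigenvector equation with the other eigenvector and compare by
    symmetry of \<open>A\<close>.\<close>
  have orth: "v \<mu> \<bullet> v \<nu> = 0" if "\<mu> \<in> ?E" "\<nu> \<in> ?E" "\<mu> \<noteq> \<nu>" for \<mu> \<nu>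
  proof -
    have "\<mu> * (v \<nu> \<bullet> v \<mu>) = \<nu> * (v \<mu> \<bullet> v \<nu>)"
      using v(3)[OF that(1) v(1)[OF that(2)]] v(3)[OF that(2) v(1)[OF that(1)]] sym by metis
    then show ?thesis using that(3) by (simp add: inner_commute)
  qed
  have "inj_on v ?E"
    by (rule inj_onI) (metis orth v(2) inner_eq_zero_iff)
  moreover have "pairwise orthogonal (v ` ?E)"
    by (auto simp: pairwise_def orthogonal_def intro!: orth)
  then have "independent (v ` ?E)"
    by (rule pairwise_orthogonal_independent) (use v(2) in auto)
  then have "finite (v ` ?E)" using independent_bound by blast
  ultimately show ?thesis using finite_imageD by blast
qed

lemma continuous_on_quadratic_form:
  fixes A :: "real ^ 'n::finite ^ 'n"
  shows "continuous_on S (\<lambda>d. d \<bullet> (A *v d))"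
  by (intro continuous_intros linear_continuous_on matrix_vector_mul_bounded_linear)

lemma linear_coeff_zero_of_nonneg:
  fixes b p :: real
  assumes "\<And>t. 0 \<le> 2 * t * b + t\<^sup>2 * p"
  shows "b = 0"
proof -
  \<comment> \<open>At \<open>t = - b / q\<close> the assumed lower bound, multiplied by
    \<open>q\<^sup>2\<close>, reads \<open>0 \<le> - (b\<^sup>2 * (2 * q - p))\<close>;
    \<open>q\<close> is positive and exceeds \<open>p\<close>, which forces
    \<open>b = 0\<close>.\<close>
  define q where "q = \<bar>p\<bar> + 1"
  have q: "q > 0" "p < q" by (auto simp: q_def)
  have "0 \<le> (2 * (- b / q) * b + (- b / q)\<^sup>2 * p) * q\<^sup>2"
    by (rule mult_nonneg_nonneg[OF assms zero_le_power2])
  also have "\<dots> = - (b\<^sup>2 * (2 * q - p))"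
    using q(1) by (simp add: power2_eq_square field_simps)
  finally have "b\<^sup>2 * (2 * q - p) \<le> 0" by simp
  moreover have "2 * q - p > 0" using q by simp
  ultimately have "b\<^sup>2 \<le> 0" by (simp add: mult_le_0_iff)
  then show ?thesis by simp
qed

text \<open>At a minimiser \<open>v\<close> of the Rayleigh quotient, \<open>d \<bullet> A d - \<mu> (d \<bullet> d)\<close> is nonnegative and vanishes,
  so its derivative at \<open>v\<close> in every direction of the subspace is zero.\<close>

lemma lambda_min_rayleigh:
  fixes A :: "real ^ 'n::finite ^ 'n"
  assumes sym: "\<And>u v. u \<bullet> (A *v v) = v \<bullet> (A *v u)" and "I \<noteq> {}"
  shows "d \<in> coord_subspace I \<Longrightarrow> lambda_min A I * (d \<bullet> d) \<le> d \<bullet> (A *v d)"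
    and "\<exists>v \<in> coord_subspace I. v \<noteq> 0 \<and> v \<bullet> (A *v v) = lambda_min A I * (v \<bullet> v)"
proof -
  let ?S = "coord_subspace I \<inter> sphere 0 1"
  have "compact ?S" using closed_coord_subspace by (intro closed_Int_compact) auto
  moreover obtain i where "i \<in> I" using \<open>I \<noteq> {}\<close> by blast
  then have "axis i 1 \<in> ?S" using coord_subspace_axis by auto
  then have "?S \<noteq> {}" by blast
  ultimately obtain v where v: "v \<in> ?S" "\<And>u. u \<in> ?S \<Longrightarrow> v \<bullet> (A *v v) \<le> u \<bullet> (A *v u)"
    using continuous_attains_inf[OF _ _ continuous_on_quadratic_form] by metis
  define \<mu> where "\<mu> = v \<bullet> (A *v v)"
  have vI: "v \<in> coord_subspace I" and v1: "v \<bullet> v = 1" and "v \<noteq> 0"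
    using v(1) by (auto simp: norm_eq_1)
  have low: "\<mu> * (d \<bullet> d) \<le> d \<bullet> (A *v d)" if "d \<in> coord_subspace I" for d
  proof (cases "d = 0")
    case False
    let ?u = "inverse (norm d) *\<^sub>R d"
    have "?u \<in> ?S" using that False by (auto simp: coord_subspace_def)
    from v(2)[OF this] have "\<mu> \<le> inverse (norm d) * (inverse (norm d) * (d \<bullet> (A *v d)))"
      by (simp add: \<mu>_def matrix_vector_mult_scaleR)
    then show ?thesis
      using False by (simp add: field_simps dot_square_norm power2_eq_square)
  qed simp
  have eig: "w \<bullet> (A *v v) = \<mu> * (w \<bullet> v)" if w: "w \<in> coord_subspace I" for w
  proof -
    let ?B = "w \<bullet> (A *v v) - \<mu> * (w \<bullet> v)" and ?P = "w \<bullet> (A *v w) - \<mu> * (w \<bullet> w)"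
    have "0 \<le> 2 * t * ?B + t\<^sup>2 * ?P" for t
    proof -
      \<comment> \<open>The constant term vanishes because \<open>v\<close> is a unit vector with
        \<open>v \<bullet> (A *v v) = \<mu>\<close>; symmetry merges the two mixed terms.\<close>
      have "(v + t *\<^sub>R w) \<bullet> (A *v (v + t *\<^sub>R w)) - \<mu> * ((v + t *\<^sub>R w) \<bullet> (v + t *\<^sub>R w)) =
          2 * t * ?B + t\<^sup>2 * ?P"
        using sym[of v w] v1
        by (simp add: matrix_vector_right_distrib matrix_vector_mult_scaleR inner_add_left
            inner_add_right inner_commute[of v w] \<mu>_def[symmetric] power2_eq_square algebra_simps)
      then show ?thesis using low[OF coord_subspace_linear[OF vI w, of t]] by simp
    qed
    then have "?B = 0" by (rule linear_coeff_zero_of_nonneg)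
    then show ?thesis by simp
  qed
  have "lambda_min A I = \<mu>"
    unfolding lambda_min_def
  proof (rule Min_eqI)
    show "finite {\<mu>. block_eigenvalue A I \<mu>}" by (rule finite_block_eigenvalues[OF sym])
    show "\<mu> \<in> {\<mu>. block_eigenvalue A I \<mu>}"
      using vI \<open>v \<noteq> 0\<close> eig by (auto simp: block_eigenvalue_iff)
    fix \<nu> assume "\<nu> \<in> {\<mu>. block_eigenvalue A I \<mu>}"
    then obtain w where w: "w \<in> coord_subspace I" "w \<noteq> 0" "w \<bullet> (A *v w) = \<nu> * (w \<bullet> w)"
      by (auto simp: block_eigenvalue_iff)
    then show "\<mu> \<le> \<nu>" using low[OF w(1)] by simp
  qed
  then show "d \<in> coord_subspace I \<Longrightarrow> lambda_min A I * (d \<bullet> d) \<le> d \<bullet> (A *v d)"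
    and "\<exists>v \<in> coord_subspace I. v \<noteq> 0 \<and> v \<bullet> (A *v v) = lambda_min A I * (v \<bullet> v)"
    using low vI v1 \<open>v \<noteq> 0\<close> by (auto simp: \<mu>_def)
qed

lemma coord_subspace_empty: "coord_subspace {} = {0}"
  by (auto simp: coord_subspace_def vec_eq_iff)

section \<open>Definiteness and the sign of the smallest eigenvalue\<close>

text \<open>One direction evaluates the form at a minimal eigenvector, the other is the Rayleigh
  bound. The empty block is a separate disjunct: it has no eigenvalues, so \<open>lambda_min\<close>
  would be the minimum of an empty set, while the subspace is just \<open>{0}\<close>.\<close>

lemma lambda_min_nonneg_iff:
  fixes A :: "real ^ 'n::finite ^ 'n"
  assumes sym: "\<And>u v. u \<bullet> (A *v v) = v \<bullet> (A *v u)"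
  shows "(\<forall>d \<in> coord_subspace I. d \<bullet> (A *v d) \<ge> 0) \<longleftrightarrow> I = {} \<or> lambda_min A I \<ge> 0"
proof (cases "I = {}")
  case False
  note R = lambda_min_rayleigh[OF sym False]
  show ?thesis
  proof
    assume L: "\<forall>d \<in> coord_subspace I. d \<bullet> (A *v d) \<ge> 0"
    obtain v where v: "v \<in> coord_subspace I" "v \<noteq> 0" "v \<bullet> (A *v v) = lambda_min A I * (v \<bullet> v)"
      using R(2) by blast
    then have "0 \<le> lambda_min A I * (v \<bullet> v)" using L by metis
    then show "I = {} \<or> lambda_min A I \<ge> 0"
      using inner_gt_zero_iff[of v] v(2) by (metis zero_le_mult_iff not_le)
  next
    assume "I = {} \<or> lambda_min A I \<ge> 0"
    then show "\<forall>d \<in> coord_subspace I. d \<bullet> (A *v d) \<ge> 0"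
      using False R(1) by (meson inner_ge_zero mult_nonneg_nonneg order_trans)
  qed
qed (simp add: coord_subspace_empty)

lemma lambda_min_pos_iff:
  fixes A :: "real ^ 'n::finite ^ 'n"
  assumes sym: "\<And>u v. u \<bullet> (A *v v) = v \<bullet> (A *v u)"
  shows "(\<forall>d \<in> coord_subspace I - {0}. d \<bullet> (A *v d) > 0) \<longleftrightarrow> I = {} \<or> lambda_min A I > 0"
proof (cases "I = {}")
  case False
  note R = lambda_min_rayleigh[OF sym False]
  show ?thesis
  proof
    assume L: "\<forall>d \<in> coord_subspace I - {0}. d \<bullet> (A *v d) > 0"
    obtain v where v: "v \<in> coord_subspace I" "v \<noteq> 0" "v \<bullet> (A *v v) = lambda_min A I * (v \<bullet> v)"
      using R(2) by blast
    then have "0 < lambda_min A I * (v \<bullet> v)" using L by (metis DiffI singletonD)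
    then show "I = {} \<or> lambda_min A I > 0"
      using inner_gt_zero_iff[of v] v(2) by (metis zero_less_mult_iff not_less_iff_gr_or_eq)
  next
    assume "I = {} \<or> lambda_min A I > 0"
    then have p: "lambda_min A I > 0" using False by simp
    show "\<forall>d \<in> coord_subspace I - {0}. d \<bullet> (A *v d) > 0"
    proof
      fix d assume d: "d \<in> coord_subspace I - {0}"
      then have "0 < lambda_min A I * (d \<bullet> d)" using p by simp
      also have "\<dots> \<le> d \<bullet> (A *v d)" using d by (intro R(1)) simp
      finally show "d \<bullet> (A *v d) > 0" .
    qed
  qed
qed (simp add: coord_subspace_empty)

section \<open>The smooth part of the objective near a point\<close>

text \<open>With \<open>I = supp x\<close> this function
  is \<open>C\<^sup>2\<close> near \<open>x\<close>, and it agrees with the objective on \<open>coord_subspace I\<close>.\<close>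

definition smooth_part ::
    "(real ^ 'n::finite \<Rightarrow> real) \<Rightarrow> real \<Rightarrow> (real \<Rightarrow> real) \<Rightarrow> 'n set \<Rightarrow> real ^ 'n \<Rightarrow> real" where
  "smooth_part f lam r I y = f y + lam * (\<Sum>i\<in>I. r \<bar>y $ i\<bar>)"

definition smooth_gradient ::
    "(real ^ 'n::finite \<Rightarrow> real) \<Rightarrow> real \<Rightarrow> (real \<Rightarrow> real) \<Rightarrow> 'n set \<Rightarrow> real ^ 'n \<Rightarrow> real ^ 'n" where
  "smooth_gradient f lam r I y =
     (\<chi> i. gradient f y $ i + (if i \<in> I then lam * (sgn (y $ i) * deriv r \<bar>y $ i\<bar>) else 0))"

text \<open>Unlike \<open>hessian (objective f lam r)\<close>, whose formula is available only on
  the block of nonzero coordinates, this matrix also carries the mixed terms with the zero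
  coordinates.\<close>

definition smooth_hessian ::
    "(real ^ 'n::finite \<Rightarrow> real) \<Rightarrow> real \<Rightarrow> (real \<Rightarrow> real) \<Rightarrow> 'n set \<Rightarrow> real ^ 'n \<Rightarrow> real ^ 'n ^ 'n" where
  "smooth_hessian f lam r I x =
     (\<chi> i j. hessian f x $ i $ j + (if i = j \<and> i \<in> I then lam * deriv (deriv r) \<bar>x $ i\<bar> else 0))"

lemma objective_eq_smooth_part:
  "objective f lam r y = smooth_part f lam r I y + lam * (\<Sum>j\<in>-I. r \<bar>y $ j\<bar>)"
proof -
  have "(\<Sum>i\<in>UNIV. r \<bar>y $ i\<bar>) = (\<Sum>i\<in>I. r \<bar>y $ i\<bar>) + (\<Sum>j\<in>-I. r \<bar>y $ j\<bar>)"
    using sum.union_disjoint[of I "-I" "\<lambda>i. r \<bar>y $ i\<bar>"] by simp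
  then show ?thesis by (simp add: objective_def smooth_part_def distrib_left)
qed

text \<open>Bridges from derivatives along a coordinate line, the form in which the penalty
  derivatives are given, to total derivatives on the whole space.\<close>

lemma has_derivative_vec_nth_comp:
  assumes "((\<lambda>t. p (y $ i + t)) has_real_derivative D) (at 0)"
  shows "((\<lambda>z. p (z $ i)) has_derivative (\<lambda>h. D * h $ i)) (at (y :: real ^ 'n::finite))"
proof -
  have "(p has_real_derivative D) (at (y $ i))"
    using assms DERIV_shift[of p D 0 "y $ i"] by (simp add: add.commute)
  then have "(p has_derivative (*) D) (at (y $ i))"
    by (simp add: has_field_derivative_def)
  from has_derivative_compose[where f = "\<lambda>z. z $ i", OF _ this] show ?thesis
    using bounded_linear_imp_has_derivative[OF bounded_linear_vec_nth] by blast
qed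

lemma has_derivative_smooth_part:
  fixes f :: "real ^ 'n::finite \<Rightarrow> real"
  assumes "f differentiable at y" "C2_on_pos r" "\<And>i. i \<in> I \<Longrightarrow> y $ i \<noteq> 0"
  shows "(smooth_part f lam r I has_derivative (\<lambda>h. smooth_gradient f lam r I y \<bullet> h)) (at y)"
proof -
  let ?c = "\<lambda>i. sgn (y $ i) * deriv r \<bar>y $ i\<bar>"
  have "((\<lambda>z. r \<bar>z $ i\<bar>) has_derivative (\<lambda>h. ?c i * h $ i)) (at y)" if "i \<in> I" for i
    using has_derivative_vec_nth_comp[of "\<lambda>t. r \<bar>t\<bar>"] has_derivative_abs_line(1)[OF assms(2,3)] that
    by blast
  then have "((\<lambda>z. f z + lam * (\<Sum>i\<in>I. r \<bar>z $ i\<bar>)) has_derivative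
      (\<lambda>h. gradient f y \<bullet> h + lam * (\<Sum>i\<in>I. ?c i * h $ i))) (at y)"
    by (intro has_derivative_add has_derivative_gradient assms has_derivative_mult_right
        has_derivative_sum)
  moreover have "gradient f y \<bullet> h + lam * (\<Sum>i\<in>I. ?c i * h $ i) = smooth_gradient f lam r I y \<bullet> h"
    for h
  proof -
    \<comment> \<open>As an indicator sum over all coordinates it merges termwise with the inner
      product.\<close>
    have "(\<Sum>i\<in>I. ?c i * h $ i) = (\<Sum>i\<in>UNIV. if i \<in> I then ?c i * h $ i else 0)"
      by (simp add: sum.If_cases)
    then show ?thesis
      by (auto simp: smooth_gradient_def inner_vec_def sum_distrib_left algebra_simps
          simp flip: sum.distrib intro!: sum.cong)
  qed
  ultimately show ?thesis by (simp add: smooth_part_def[abs_def])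
qed

lemma smooth_hessian_mult_nth:
  "(smooth_hessian f lam r I x *v h) $ i =
    (hessian f x *v h) $ i + (if i \<in> I then lam * deriv (deriv r) \<bar>x $ i\<bar> * h $ i else 0)"
proof -
  have "(smooth_hessian f lam r I x *v h) $ i = (\<Sum>j\<in>UNIV. hessian f x $ i $ j * h $ j +
      (if i = j then (if i \<in> I then lam * deriv (deriv r) \<bar>x $ i\<bar> * h $ i else 0) else 0))"
    unfolding matrix_vector_mult_def smooth_hessian_def by (auto simp: algebra_simps intro!: sum.cong)
  then show ?thesis by (simp add: sum.distrib matrix_vector_mult_def)
qed

lemma has_derivative_smooth_gradient:
  fixes f :: "real ^ 'n::finite \<Rightarrow> real"
  assumes "gradient f differentiable at x" "C2_on_pos r" "\<And>i. i \<in> I \<Longrightarrow> x $ i \<noteq> 0"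
  shows "(smooth_gradient f lam r I has_derivative (\<lambda>h. smooth_hessian f lam r I x *v h)) (at x)"
proof -
  have "((\<lambda>y. smooth_gradient f lam r I y $ i) has_derivative
      (\<lambda>h. (smooth_hessian f lam r I x *v h) $ i)) (at x)" for i
  proof -
    have H: "((\<lambda>y. gradient f y $ i) has_derivative (\<lambda>h. (hessian f x *v h) $ i)) (at x)"
      by (intro bounded_linear.has_derivative[OF bounded_linear_vec_nth] has_derivative_hessian assms)
    show ?thesis
    proof (cases "i \<in> I")
      case True
      have "((\<lambda>y. sgn (y $ i) * deriv r \<bar>y $ i\<bar>) has_derivative
          (\<lambda>h. deriv (deriv r) \<bar>x $ i\<bar> * h $ i)) (at x)"
        using has_derivative_vec_nth_comp[of "\<lambda>t. sgn t * deriv r \<bar>t\<bar>"]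
          has_derivative_abs_line(2)[OF assms(2) assms(3)[OF True]] by blast
      from has_derivative_add[OF H has_derivative_mult_right[OF this, of lam]] True
      show ?thesis by (simp add: smooth_gradient_def smooth_hessian_mult_nth mult.assoc)
    next
      case False
      with H show ?thesis by (simp add: smooth_gradient_def smooth_hessian_mult_nth)
    qed
  qed
  then show ?thesis
    by (subst has_derivative_componentwise_within) (auto simp: Basis_vec_def inner_axis)
qed

text \<open>Valid for every \<open>d\<close>, not only in the subspace, so one matrix serves both
  the Taylor expansion in all directions and the Rayleigh bound.\<close>

lemma second_order_form_eq:
  "second_order_form f lam r x d = d \<bullet> (smooth_hessian f lam r (supp x) x *v d)"
proof -
  have "(\<Sum>i\<in>supp x. lam * (deriv (deriv r) \<bar>x $ i\<bar> * (d $ i)\<^sup>2)) =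
      (\<Sum>i\<in>UNIV. if i \<in> supp x then lam * (deriv (deriv r) \<bar>x $ i\<bar> * (d $ i)\<^sup>2) else 0)"
    by (simp add: sum.If_cases)
  then show ?thesis
    by (auto simp: second_order_form_def inner_vec_def smooth_hessian_mult_nth sum_distrib_left
        power2_eq_square algebra_simps simp flip: sum.distrib intro!: sum.cong)
qed

lemma smooth_hessian_symmetric:
  fixes f :: "real ^ 'n::finite \<Rightarrow> real"
  assumes "twice_continuously_differentiable f"
  shows "u \<bullet> (smooth_hessian f lam r I x *v v) = v \<bullet> (smooth_hessian f lam r I x *v u)"
proof -
  let ?D = "\<lambda>v. \<chi> i. if i \<in> I then lam * deriv (deriv r) \<bar>x $ i\<bar> * v $ i else 0"
  have "smooth_hessian f lam r I x *v v = hessian f x *v v + ?D v" for v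
    by (simp add: vec_eq_iff smooth_hessian_mult_nth)
  moreover have "u \<bullet> ?D v = v \<bullet> ?D u"
    by (auto simp: inner_vec_def intro!: sum.cong)
  ultimately show ?thesis
    using hessian_symmetric[OF assms, of u x v] by (simp add: inner_add_right)
qed

text \<open>These are finitely many open conditions. They make \<open>smooth_part\<close>
  differentiable throughout a neighbourhood, as the Taylor expansion demands.\<close>

lemma eventually_nhds_supp: "\<forall>\<^sub>F y in nhds x. \<forall>i \<in> supp x. y $ i \<noteq> (0::real)"
proof (intro eventually_ball_finite ballI)
  fix i assume "i \<in> supp x"
  moreover have "open {y :: real ^ 'a. y $ i \<noteq> 0}"
    by (intro open_Collect_neq continuous_intros)
  ultimately show "\<forall>\<^sub>F y in nhds x. y $ i \<noteq> 0"
    by (auto simp: supp_def eventually_nhds intro!: exI[of _ "{y :: real ^ 'a. y $ i \<noteq> 0}"])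
qed simp

lemma smooth_part_Taylor:
  fixes f :: "real ^ 'n::finite \<Rightarrow> real"
  assumes f: "twice_continuously_differentiable f" and r: "C2_on_pos r" and "e > 0"
  shows "\<forall>\<^sub>F h in nhds 0. \<bar>smooth_part f lam r (supp x) (x + h) - smooth_part f lam r (supp x) x
    - smooth_gradient f lam r (supp x) x \<bullet> h - second_order_form f lam r x h / 2\<bar> \<le> e * (norm h)\<^sup>2"
  unfolding second_order_form_eq
proof (rule second_order_Taylor_Peano[where f = "smooth_part f lam r (supp x)" and
      g = "smooth_gradient f lam r (supp x)" and G = "(*v) (smooth_hessian f lam r (supp x) x)"])
  show "\<forall>\<^sub>F y in nhds x. (smooth_part f lam r (supp x) has_derivative
      (\<lambda>h. smooth_gradient f lam r (supp x) y \<bullet> h)) (at y)"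
    using eventually_nhds_supp[of x]
  proof eventually_elim
    case (elim y)
    then show ?case
      using f r by (intro has_derivative_smooth_part) (auto simp: twice_continuously_differentiable_def)
  qed
  show "(smooth_gradient f lam r (supp x) has_derivative (*v) (smooth_hessian f lam r (supp x) x)) (at x)"
    using f r
    by (intro has_derivative_smooth_gradient) (auto simp: twice_continuously_differentiable_def supp_def)
qed fact

section \<open>Optimality conditions\<close>

text \<open>Adding the expansions along \<open>d\<close> and \<open>-d\<close> cancels the linear term.\<close>

lemma local_minimum_second_order_form_nonneg:
  fixes f :: "real ^ 'n::finite \<Rightarrow> real"
  assumes f: "twice_continuously_differentiable f" and r: "C2_on_pos r"
    and min: "local_minimum (objective f lam r) x" and d: "d \<in> coord_subspace (supp x)"
  shows "second_order_form f lam r x d \<ge> 0"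
proof (rule field_le_epsilon)
  fix e :: real assume e: "e > 0"
  let ?T = "smooth_part f lam r (supp x)" and ?g = "smooth_gradient f lam r (supp x) x"
  let ?Q = "second_order_form f lam r x"
  \<comment> \<open>With \<open>\<eta> = e / (2 * k)\<close> the two Taylor errors add up to at most
    \<open>e\<close> per unit of \<open>t\<^sup>2\<close>; the \<open>+ 1\<close> covers
    \<open>d = 0\<close>.\<close>
  define k where "k = (norm d)\<^sup>2 + 1"
  define \<eta> where "\<eta> = e / (2 * k)"
  have n: "k > 0" by (simp add: k_def add_nonneg_pos)
  have \<eta>: "\<eta> > 0" using e n by (simp add: \<eta>_def)
  have "\<forall>\<^sub>F h in nhds 0. objective f lam r x \<le> objective f lam r (x + h)"
  proof (rule eventually_compose_filterlim[where f = "\<lambda>h. x + h" and F = "nhds x"])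
    show "\<forall>\<^sub>F y in nhds x. objective f lam r x \<le> objective f lam r y"
      using min by (simp add: local_minimum_def)
    have "((\<lambda>h. x + h) \<longlongrightarrow> x + 0) (nhds 0)"
      by (intro tendsto_intros filterlim_ident)
    then show "filterlim (\<lambda>h. x + h) (nhds x) (nhds 0)" by simp
  qed
  with smooth_part_Taylor[OF f r \<eta>]
  have "\<forall>\<^sub>F h in nhds 0. objective f lam r x \<le> objective f lam r (x + h) \<and>
      \<bar>?T (x + h) - ?T x - ?g \<bullet> h - ?Q h / 2\<bar> \<le> \<eta> * (norm h)\<^sup>2"
    by eventually_elim blast
  then obtain \<rho> where \<rho>: "\<rho> > 0" "\<And>h. norm h < \<rho> \<Longrightarrow> objective f lam r x \<le> objective f lam r (x + h)"
    "\<And>h. norm h < \<rho> \<Longrightarrow> \<bar>?T (x + h) - ?T x - ?g \<bullet> h - ?Q h / 2\<bar> \<le> \<eta> * (norm h)\<^sup>2"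
    by (auto simp: eventually_nhds_metric dist_norm)
  define t where "t = \<rho> / (norm d + 1)"
  have t: "t > 0" using \<rho>(1) by (simp add: t_def add_nonneg_pos)
  have "t * norm d < t * (norm d + 1)" using t by simp
  also have "\<dots> = \<rho>" using norm_ge_zero[of d] by (simp add: t_def add_nonneg_eq_0_iff)
  finally have sm: "norm (t *\<^sub>R d) < \<rho>" "norm (- (t *\<^sub>R d)) < \<rho>" using t by auto
  \<comment> \<open>Moving along \<open>d\<close> leaves the zero coordinates fixed, so their
    penalties cancel in the difference.\<close>
  have eqT: "objective f lam r (x + s *\<^sub>R d) - objective f lam r x = ?T (x + s *\<^sub>R d) - ?T x" for s
    using d by (simp add: objective_eq_smooth_part[of f lam r _ "supp x"] coord_subspace_def)
  have Qs: "?Q (s *\<^sub>R d) = s\<^sup>2 * ?Q d" for s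
    by (simp add: second_order_form_eq matrix_vector_mult_scaleR power2_eq_square)
  have p: "?T x \<le> ?T (x + t *\<^sub>R d)" "?T x \<le> ?T (x - t *\<^sub>R d)"
    using \<rho>(2)[OF sm(1)] \<rho>(2)[OF sm(2)] eqT[of t] eqT[of "-t"] by simp_all
  have "?T (x + t *\<^sub>R d) - ?T x - t * (?g \<bullet> d) - t\<^sup>2 * ?Q d / 2 \<le> \<eta> * (t\<^sup>2 * (norm d)\<^sup>2)"
    using \<rho>(3)[OF sm(1)] Qs[of t] by (simp add: power_mult_distrib)
  moreover have "?T (x - t *\<^sub>R d) - ?T x + t * (?g \<bullet> d) - t\<^sup>2 * ?Q d / 2 \<le> \<eta> * (t\<^sup>2 * (norm d)\<^sup>2)"
    using \<rho>(3)[OF sm(2)] Qs[of "-t"] by (simp add: power_mult_distrib)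
  ultimately have "0 \<le> t\<^sup>2 * ?Q d + 2 * (\<eta> * (t\<^sup>2 * (norm d)\<^sup>2))"
    using p by (simp add: field_simps)
  then have "0 \<le> t\<^sup>2 * (?Q d + 2 * \<eta> * (norm d)\<^sup>2)" by (simp add: algebra_simps)
  then have "0 \<le> ?Q d + 2 * \<eta> * (norm d)\<^sup>2" using t by (simp add: zero_le_mult_iff)
  also have "2 * \<eta> * (norm d)\<^sup>2 \<le> 2 * \<eta> * k" using \<eta> by (simp add: k_def)
  also have "\<dots> = e" using n by (simp add: \<eta>_def)
  finally show "0 \<le> ?Q d + e" by simp
qed

text \<open>A slope of \<open>r\<close> at \<open>0\<close> strictly between \<open>\<gamma> / lam\<close> and \<open>r'(0+)\<close> works also when
  \<open>r'(0+) = \<infinity>\<close>.\<close>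

lemma penalty_linear_growth:
  assumes r: "admissible_penalty r" and lam: "lam > 0"
    and \<gamma>: "ereal \<gamma> < ereal lam * deriv_at_0_plus r"
  obtains \<delta> \<rho> where "\<delta> > 0" "\<rho> > 0" "\<And>t. \<bar>t\<bar> < \<rho> \<Longrightarrow> (\<gamma> + \<delta>) * \<bar>t\<bar> \<le> lam * r \<bar>t\<bar>"
proof -
  have "ereal (\<gamma> / lam) < deriv_at_0_plus r"
    using \<gamma> lam by (cases "deriv_at_0_plus r") (auto simp: field_simps)
  then obtain c where c: "\<gamma> / lam < c" "ereal c < deriv_at_0_plus r"
    using ereal_dense2[of "ereal (\<gamma> / lam)" "deriv_at_0_plus r"] by auto
  have "((\<lambda>t. ereal (deriv r t)) \<longlongrightarrow> deriv_at_0_plus r) (at_right 0)"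
    using r by (simp add: admissible_penalty_def)
  from order_tendstoD(1)[OF this c(2)]
  have "\<forall>\<^sub>F t in at_right 0. c < deriv r t" by simp
  then obtain \<rho> where \<rho>: "\<rho> > 0" "\<And>t. 0 < t \<Longrightarrow> t < \<rho> \<Longrightarrow> c < deriv r t"
    by (auto simp: eventually_at_right_field)
  show ?thesis
  \<comment> \<open>This choice makes \<open>\<gamma> + \<delta> = lam * c\<close>, which reduces
    the claim to \<open>c * \<bar>t\<bar> \<le> r \<bar>t\<bar>\<close>.\<close>
  proof (rule that[of "lam * c - \<gamma>" \<rho>])
    show "lam * c - \<gamma> > 0" using c(1) lam by (simp add: field_simps)
    fix t :: real assume t: "\<bar>t\<bar> < \<rho>"
    have "c * \<bar>t\<bar> \<le> r \<bar>t\<bar>"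
    proof (cases "t = 0")
      case False
      \<comment> \<open>Mean value theorem on the closed interval from 0: \<open>r\<close> is
        continuous there and differentiable in the interior, where the slope exceeds
        \<open>c\<close>.\<close>
      have "\<exists>s>0. s < \<bar>t\<bar> \<and> r \<bar>t\<bar> - r 0 = (\<bar>t\<bar> - 0) * deriv r s"
      proof -
        have "continuous_on {0..\<bar>t\<bar>} r"
          using r by (auto simp: admissible_penalty_def intro: continuous_on_subset)
        moreover have "(r has_real_derivative deriv r s) (at s)" if "0 < s" for s
          using r that
          by (simp add: admissible_penalty_def C2_on_pos_def DERIV_deriv_iff_field_differentiable)
        ultimately obtain l s where "0 < s" "s < \<bar>t\<bar>" "(r has_real_derivative l) (at s)"
            "r \<bar>t\<bar> - r 0 = (\<bar>t\<bar> - 0) * l"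
          using MVT[of 0 "\<bar>t\<bar>" r] False by (force simp: real_differentiable_def)
        then show ?thesis using DERIV_imp_deriv by blast
      qed
      then obtain s where "0 < s" "s < \<bar>t\<bar>" "r \<bar>t\<bar> = \<bar>t\<bar> * deriv r s"
        using r by (auto simp: admissible_penalty_def)
      then show ?thesis using \<rho>(2)[of s] t by (simp add: mult.commute[of c] mult_left_mono)
    qed (use r in \<open>simp add: admissible_penalty_def\<close>)
    then have "lam * (c * \<bar>t\<bar>) \<le> lam * r \<bar>t\<bar>" using lam by simp
    then show "(\<gamma> + (lam * c - \<gamma>)) * \<bar>t\<bar> \<le> lam * r \<bar>t\<bar>" by (simp add: mult.assoc)
  qed (use \<rho> in auto)
qed

lemma ereal_abs_less_of_mem:
  assumes "ereal a \<in> {- L <..< L}"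
  shows "ereal \<bar>a\<bar> < L"
  using assms by (cases L) (auto simp: abs_if)

text \<open>Split \<open>h = d + w\<close> with \<open>d\<close> in the subspace of the nonzero coordinates. The objective grows
  at least quadratically in \<open>d\<close> and linearly in \<open>w\<close>, and linear growth in \<open>w\<close> absorbs the mixed
  terms of the expansion, which are of order \<open>norm h * norm w\<close>.\<close>

lemma stationary_strict_local_minimum:
  fixes f :: "real ^ 'n::finite \<Rightarrow> real"
  assumes f: "twice_continuously_differentiable f" and r: "admissible_penalty r" and lam: "lam > 0"
    and stat: "stationary f lam r x"
    and pos: "\<And>d. d \<in> coord_subspace (supp x) \<Longrightarrow> d \<noteq> 0 \<Longrightarrow> second_order_form f lam r x d > 0"
  shows "strict_local_minimum (objective f lam r) x"
proof -
  let ?I = "supp x" and ?F = "objective f lam r"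
  let ?T = "smooth_part f lam r ?I" and ?g = "smooth_gradient f lam r ?I x"
  let ?S = "smooth_hessian f lam r ?I x"
  let ?Q = "second_order_form f lam r x"
  have r2: "C2_on_pos r" and r0: "r 0 = 0" using r by (auto simp: admissible_penalty_def)
  \<comment> \<open>The coercivity constant is \<open>lambda_min\<close>; for empty support the
    subspace is \<open>{0}\<close> and any positive constant will do.\<close>
  obtain m where m: "m > 0" "\<And>d. d \<in> coord_subspace ?I \<Longrightarrow> m * (norm d)\<^sup>2 \<le> ?Q d"
  proof (cases "?I = {}")
    case True
    then show ?thesis
      using that[of 1] by (simp add: coord_subspace_empty second_order_form_eq)
  next
    case False
    have sym: "u \<bullet> (?S *v v) = v \<bullet> (?S *v u)" for u v by (rule smooth_hessian_symmetric[OF f])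
    have "lambda_min ?S ?I > 0"
      using lambda_min_pos_iff[of ?S ?I, OF sym] pos False by (auto simp: second_order_form_eq)
    then show ?thesis
      using that[of "lambda_min ?S ?I"] lambda_min_rayleigh(1)[of ?S, OF sym False]
      by (simp add: second_order_form_eq dot_square_norm)
  qed
  obtain K where K: "K > 0" "\<And>v. norm (?S *v v) \<le> K * norm v"
    using bounded_linear.pos_bounded[OF matrix_vector_mul_bounded_linear[of ?S]]
    by (auto simp: mult.commute)
  \<comment> \<open>Inserting 0 keeps the set nonempty when there are no zero coordinates. Every
    element lies strictly below \<open>lam * r'(0+)\<close>, hence so does the maximum of this
    finite set.\<close>
  define \<gamma> where "\<gamma> = Max (insert 0 ((\<lambda>j. \<bar>gradient f x $ j\<bar>) ` (- ?I)))"
  have "\<gamma> \<in> insert 0 ((\<lambda>j. \<bar>gradient f x $ j\<bar>) ` (- ?I))"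
    unfolding \<gamma>_def by (intro Max_in) auto
  moreover have "0 < ereal lam * deriv_at_0_plus r"
    using r lam by (simp add: admissible_penalty_def ereal_zero_less_0_iff)
  moreover have "ereal \<bar>gradient f x $ j\<bar> < ereal lam * deriv_at_0_plus r" if "j \<in> - ?I" for j
    using stat that by (intro ereal_abs_less_of_mem) (simp add: stationary_def)
  ultimately have "ereal \<gamma> < ereal lam * deriv_at_0_plus r"
    by (auto simp: zero_ereal_def)
  then obtain \<delta> \<rho>1 where \<delta>: "\<delta> > 0" "\<rho>1 > 0"
      "\<And>t. \<bar>t\<bar> < \<rho>1 \<Longrightarrow> (\<gamma> + \<delta>) * \<bar>t\<bar> \<le> lam * r \<bar>t\<bar>"
    using penalty_linear_growth[OF r lam] by metis
  have \<gamma>: "\<bar>gradient f x $ j\<bar> \<le> \<gamma>" if "j \<in> - ?I" for j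
    unfolding \<gamma>_def using that by (intro Max_ge) auto
  \<comment> \<open>Half the quadratic form supplies \<open>m / 2\<close> times
    \<open>(norm d)\<^sup>2\<close>; a Taylor error of \<open>m / 4\<close> leaves another
    \<open>m / 4\<close> over.\<close>
  have "m / 4 > 0" using m by simp
  from smooth_part_Taylor[OF f r2 this]
  obtain \<rho>2 where \<rho>2: "\<rho>2 > 0"
    "\<And>h. norm h < \<rho>2 \<Longrightarrow> \<bar>?T (x + h) - ?T x - ?g \<bullet> h - ?Q h / 2\<bar> \<le> m / 4 * (norm h)\<^sup>2"
    unfolding eventually_nhds_metric dist_norm diff_0_right by blast
  \<comment> \<open>The last bound makes \<open>norm h * (K + m / 4) < \<delta>\<close>, so the
    slope \<open>\<delta>\<close> in \<open>norm w\<close> beats the mixed terms and the part of the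
    Taylor error in \<open>w\<close>.\<close>
  define \<rho> where "\<rho> = min (min \<rho>1 \<rho>2) (\<delta> / (K + m / 4))"
  have \<rho>: "\<rho> > 0" using \<delta> \<rho>2 K m by (simp add: \<rho>_def)
  have "?F x < ?F (x + h)" if h: "norm h < \<rho>" "h \<noteq> 0" for h
  proof -
    define d where "d = (\<chi> i. if i \<in> ?I then h $ i else 0)"
    define w where "w = h - d"
    have hdw: "h = d + w" by (simp add: w_def)
    have wi: "w $ j = (if j \<in> ?I then 0 else h $ j)" for j by (simp add: w_def d_def)
    have "d \<bullet> w = 0" by (simp add: inner_vec_def wi) (simp add: d_def sum.neutral)
    then have n2: "(norm h)\<^sup>2 = (norm d)\<^sup>2 + (norm w)\<^sup>2"
      by (simp add: hdw power2_norm_eq_inner inner_add_left inner_add_right inner_commute)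
    then have nd: "norm d \<le> norm h" and nw: "norm w \<le> norm h"
      by (simp_all add: power2_le_imp_le)
    \<comment> \<open>Grouped so that every term other than \<open>?Q d\<close> contains
      \<open>w\<close>.\<close>
    have "?Q h = ?Q d + (w \<bullet> (?S *v d) + h \<bullet> (?S *v w))"
      by (simp add: hdw second_order_form_eq matrix_vector_right_distrib inner_add_left inner_add_right)
    moreover have "\<bar>w \<bullet> (?S *v d)\<bar> \<le> K * norm h * norm w"
    proof -
      have "\<bar>w \<bullet> (?S *v d)\<bar> \<le> norm w * (K * norm d)"
        by (rule order_trans[OF Cauchy_Schwarz_ineq2]) (intro mult_left_mono K norm_ge_zero)
      also have "\<dots> \<le> norm w * (K * norm h)"
        using nd K(1) by (intro mult_left_mono) auto
      finally show ?thesis by (simp add: mult_ac)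
    qed
    moreover have "\<bar>h \<bullet> (?S *v w)\<bar> \<le> K * norm h * norm w"
    proof -
      have "\<bar>h \<bullet> (?S *v w)\<bar> \<le> norm h * (K * norm w)"
        by (rule order_trans[OF Cauchy_Schwarz_ineq2]) (intro mult_left_mono K norm_ge_zero)
      then show ?thesis by (simp add: mult_ac)
    qed
    moreover have "d \<in> coord_subspace ?I" by (simp add: coord_subspace_def d_def)
    ultimately have Q: "?Q h / 2 \<ge> m * (norm d)\<^sup>2 / 2 - K * norm h * norm w"
      using m(2)[of d] by linarith
    have "?F x = ?T x"
      by (simp add: objective_eq_smooth_part[of f lam r x ?I] supp_def r0)
    moreover have "?F (x + h) = ?T (x + h) + lam * (\<Sum>j\<in>-?I. r \<bar>h $ j\<bar>)"
      by (simp add: objective_eq_smooth_part[of f lam r _ ?I] supp_def)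
    moreover have "\<delta> * norm w \<le> ?g \<bullet> h + lam * (\<Sum>j\<in>-?I. r \<bar>h $ j\<bar>)"
    proof -
      \<comment> \<open>Passing to the 1-norm reduces the claim to one inequality per zero
        coordinate.\<close>
      have "\<delta> * norm w \<le> \<delta> * (\<Sum>j\<in>UNIV. \<bar>w $ j\<bar>)"
        using \<delta>(1) norm_le_l1_cart[of w] by simp
      also have "(\<Sum>j\<in>UNIV. \<bar>w $ j\<bar>) = (\<Sum>j\<in>-?I. \<bar>h $ j\<bar>)"
        by (rule sum.mono_neutral_cong_right) (auto simp: wi)
      also have "\<delta> * (\<Sum>j\<in>-?I. \<bar>h $ j\<bar>) = (\<Sum>j\<in>-?I. \<delta> * \<bar>h $ j\<bar>)"
        by (rule sum_distrib_left)
      also have "\<dots> \<le> (\<Sum>j\<in>-?I. ?g $ j * h $ j + lam * r \<bar>h $ j\<bar>)"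
      proof (rule sum_mono)
        fix j assume j: "j \<in> - ?I"
        have "\<bar>h $ j\<bar> < \<rho>1"
          using component_le_norm_cart[of h j] h(1) by (simp add: \<rho>_def)
        from \<delta>(3)[OF this] have "\<gamma> * \<bar>h $ j\<bar> + \<delta> * \<bar>h $ j\<bar> \<le> lam * r \<bar>h $ j\<bar>"
          by (simp add: distrib_right)
        moreover have "\<bar>gradient f x $ j * h $ j\<bar> \<le> \<gamma> * \<bar>h $ j\<bar>"
          using \<gamma>[OF j] by (simp add: abs_mult mult_right_mono)
        moreover have "?g $ j = gradient f x $ j" using j by (simp add: smooth_gradient_def)
        ultimately show "\<delta> * \<bar>h $ j\<bar> \<le> ?g $ j * h $ j + lam * r \<bar>h $ j\<bar>" by simp
      qed
      also have "\<dots> = (\<Sum>j\<in>-?I. ?g $ j * h $ j) + lam * (\<Sum>j\<in>-?I. r \<bar>h $ j\<bar>)"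
        by (simp add: sum.distrib sum_distrib_left)
      \<comment> \<open>Stationarity makes \<open>?g\<close> vanish on the support, so only the zero
        coordinates contribute.\<close>
      also have "(\<Sum>j\<in>-?I. ?g $ j * h $ j) = ?g \<bullet> h"
        unfolding inner_vec_def inner_real_def
        by (rule sum.mono_neutral_left) (use stat in \<open>auto simp: stationary_def smooth_gradient_def\<close>)
      finally show ?thesis .
    qed
    moreover have "?T (x + h) - ?T x - ?g \<bullet> h - ?Q h / 2 \<ge> - (m / 4 * (norm h)\<^sup>2)"
    proof -
      have "norm h < \<rho>2" using h(1) by (simp add: \<rho>_def)
      from \<rho>2(2)[OF this] show ?thesis by linarith
    qed
    \<comment> \<open>Recasts the Taylor error in \<open>w\<close> as a mixed term, to be absorbed
      by the linear growth.\<close>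
    moreover have "m / 4 * (norm w)\<^sup>2 \<le> m / 4 * norm h * norm w"
      using nw m(1) by (simp add: power2_eq_square mult_right_mono)
    moreover have "m / 4 * (norm h)\<^sup>2 = m / 4 * (norm d)\<^sup>2 + m / 4 * (norm w)\<^sup>2"
      by (simp add: n2 distrib_left)
    ultimately have "?F (x + h) - ?F x \<ge> m / 4 * (norm d)\<^sup>2 +
        (\<delta> * norm w - (K * norm h * norm w + m / 4 * norm h * norm w))"
      using Q by linarith
    moreover have "m / 4 * (norm d)\<^sup>2 +
        (\<delta> * norm w - (K * norm h * norm w + m / 4 * norm h * norm w)) > 0"
    proof -
      have "norm h * (K + m / 4) < \<delta>"
        using h(1) K m by (simp add: \<rho>_def pos_less_divide_eq)
      then have c: "\<delta> - norm h * (K + m / 4) > 0" by simp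
      \<comment> \<open>Strictness comes from the quadratic term if \<open>w = 0\<close>, since then
        \<open>d \<noteq> 0\<close>, and from the linear term otherwise.\<close>
      have "m / 4 * (norm d)\<^sup>2 + norm w * (\<delta> - norm h * (K + m / 4)) > 0"
      proof (cases "w = 0")
        case True
        with h(2) hdw have "d \<noteq> 0" by auto
        with True m(1) show ?thesis by simp
      next
        case False
        with c m(1) show ?thesis by (intro add_nonneg_pos mult_pos_pos) auto
      qed
      then show ?thesis by (simp add: algebra_simps)
    qed
    ultimately show ?thesis by linarith
  qed
  note less = this
  have "?F x < ?F y" if "y \<noteq> x" "dist y x < \<rho>" for y
    using less[of "y - x"] that by (simp add: dist_norm)
  then show ?thesis
    unfolding strict_local_minimum_def eventually_at using \<rho> by auto
qed

section \<open>Transfer to the Hessian of the objective and conclusion\<close>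

text \<open>The two matrices agree on the block, and \<open>lambda_min\<close> sees nothing
  else.\<close>

lemma lambda_min_hessian_objective:
  fixes f :: "real ^ 'n::finite \<Rightarrow> real"
  assumes "twice_continuously_differentiable f" "C2_on_pos r"
  shows "lambda_min (hessian (objective f lam r) x) (supp x) =
    lambda_min (smooth_hessian f lam r (supp x) x) (supp x)"
  by (rule lambda_min_cong) (simp add: hessian_objective[OF assms] smooth_hessian_def)

theorem theorem2p4:
  fixes f :: "real ^ 'n::finite \<Rightarrow> real" and r :: "real \<Rightarrow> real" and lam :: real
    and xs :: "real ^ 'n"
  assumes "twice_continuously_differentiable f"
    and "lam > 0"
    and "admissible_penalty r"
  shows "(local_minimum (objective f lam r) xs \<longrightarrow>
            (\<forall>d \<in> coord_subspace (supp xs). second_order_form f lam r xs d \<ge> 0)) \<and>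
         ((\<forall>d \<in> coord_subspace (supp xs). second_order_form f lam r xs d \<ge> 0) \<longleftrightarrow>
            (supp xs = {} \<or> lambda_min (hessian (objective f lam r) xs) (supp xs) \<ge> 0)) \<and>
         (stationary f lam r xs \<and>
          (\<forall>d \<in> coord_subspace (supp xs) - {0}. second_order_form f lam r xs d > 0) \<longrightarrow>
            strict_local_minimum (objective f lam r) xs) \<and>
         ((\<forall>d \<in> coord_subspace (supp xs) - {0}. second_order_form f lam r xs d > 0) \<longleftrightarrow>
            (supp xs = {} \<or> lambda_min (hessian (objective f lam r) xs) (supp xs) > 0))"
proof (intro conjI impI)
  have r: "C2_on_pos r" using assms(3) by (simp add: admissible_penalty_def)
  show "local_minimum (objective f lam r) xs \<Longrightarrow>
      \<forall>d \<in> coord_subspace (supp xs). second_order_form f lam r xs d \<ge> 0"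
    using local_minimum_second_order_form_nonneg[OF assms(1) r] by blast
  show "stationary f lam r xs \<and>
      (\<forall>d \<in> coord_subspace (supp xs) - {0}. second_order_form f lam r xs d > 0) \<Longrightarrow>
      strict_local_minimum (objective f lam r) xs"
    using stationary_strict_local_minimum[OF assms(1,3,2)] by blast
  note sym = smooth_hessian_symmetric[OF assms(1)]
  show "(\<forall>d \<in> coord_subspace (supp xs). second_order_form f lam r xs d \<ge> 0) \<longleftrightarrow>
      (supp xs = {} \<or> lambda_min (hessian (objective f lam r) xs) (supp xs) \<ge> 0)"
    unfolding second_order_form_eq lambda_min_hessian_objective[OF assms(1) r]
    by (rule lambda_min_nonneg_iff) (rule sym)
  show "(\<forall>d \<in> coord_subspace (supp xs) - {0}. second_order_form f lam r xs d > 0) \<longleftrightarrow>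
      (supp xs = {} \<or> lambda_min (hessian (objective f lam r) xs) (supp xs) > 0)"
    unfolding second_order_form_eq lambda_min_hessian_objective[OF assms(1) r]
    by (rule lambda_min_pos_iff) (rule sym)
qed

end
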